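(* For every even integer $d\ge 2$ and every real $\alpha>1$, there exists a Cantor set $K$ in $\mathbb{R}^d$ with $\dim_H(K)=\frac d2$ such that the pinned distance set satisfies $\big(\Delta^{(\alpha)}_t(K)\big)^\circ\neq\varnothing$ for some $t\in K$.
   Context: A Cantor set in $\mathbb{R}^d$ is a (non-empty) compact, totally disconnected, perfect subset of $\mathbb{R}^d$. $\dim_H$ denotes Hausdorff dimension. For $\alpha>1$ and $x\in\mathbb{R}^d$, $\|x\|_\alpha=\big(\sum_{i=1}^d|x_i|^\alpha\big)^{1/\alpha}$. For $A\subset\mathbb{R}^d$ and $t\in\mathbb{R}^d$, the pinned distance set at $t$ is $\Delta_t^{(\alpha)}(A)=\{\|x-t\|_\alpha:x\in A\}\subset\mathbb{R}$. $E^\circ$ denotes the interior of $E$ (here in $\mathbb{R}$). *)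

theory Defs
  imports "HOL-Analysis.Analysis"
begin

definition totally_disconnected :: "'a::topological_space set \<Rightarrow> bool" where
  "totally_disconnected K \<longleftrightarrow> (\<forall>x\<in>K. connected_component_set K x = {x})"

definition perfect :: "'a::topological_space set \<Rightarrow> bool" where
  "perfect K \<longleftrightarrow> closed K \<and> (\<forall>x\<in>K. x islimpt K)"

definition cantor_set :: "'a::topological_space set \<Rightarrow> bool" where
  "cantor_set K \<longleftrightarrow> K \<noteq> {} \<and> compact K \<and> totally_disconnected K \<and> perfect K"

(* The term diam(U)^s of a Hausdorff sum, with the conventions that the empty set
   contributes 0 and that 0^0 = 1 for nonempty U (whereas 0 powr 0 = 0). *)
definition diam_pow :: "real \<Rightarrow> 'a::metric_space set \<Rightarrow> ennreal" where
  "diam_pow s U = (if U = {} then 0 else if s = 0 then 1 else ennreal (diameter U powr s))"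

(* Boundedness is required explicitly because the real-valued diameter of an
   unbounded set is an unspecified number.  Finite covers are included, padded with {}. *)
definition hausdorff_premeasure :: "real \<Rightarrow> real \<Rightarrow> 'a::metric_space set \<Rightarrow> ennreal" where
  "hausdorff_premeasure s \<delta> A =
     (INF U \<in> {U :: nat \<Rightarrow> 'a set. A \<subseteq> (\<Union>i. U i) \<and> (\<forall>i. bounded (U i) \<and> diameter (U i) \<le> \<delta>)}.
        \<Sum>i. diam_pow s (U i))"

definition hausdorff_measure :: "real \<Rightarrow> 'a::metric_space set \<Rightarrow> ennreal" where
  "hausdorff_measure s A = (SUP \<delta> \<in> {0<..}. hausdorff_premeasure s \<delta> A)"

definition hausdorff_dim :: "'a::metric_space set \<Rightarrow> ennreal" where
  "hausdorff_dim A = (INF s \<in> {s. 0 \<le> s \<and> hausdorff_measure s A = 0}. ennreal s)"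

definition alpha_norm :: "real \<Rightarrow> real ^ 'n \<Rightarrow> real" where
  "alpha_norm \<alpha> x = (\<Sum>i\<in>UNIV. \<bar>x $ i\<bar> powr \<alpha>) powr (1 / \<alpha>)"

definition pinned_distance_set :: "real \<Rightarrow> real ^ 'n \<Rightarrow> (real ^ 'n) set \<Rightarrow> real set" where
  "pinned_distance_set \<alpha> t A = (\<lambda>x. alpha_norm \<alpha> (x - t)) ` A"

end

theory Submission
  imports Defs
begin

text \<open>
  Let \<open>A\<close> be the set of sums of distinct powers \<open>4\<^sup>-\<^sup>k\<close>, \<open>k \<ge> 1\<close>; it has dimension \<open>1/2\<close>.  Splitting the
  binary digits of a number by the parity of their position gives \<open>A + 2A = [0,1]\<close>.  With
  \<open>h(a) = (1 + a)\<^sup>1\<^sup>/\<^sup>\<alpha>\<close>, a point whose only nonzero coordinates are \<open>h(a)\<close> and \<open>h(2b)\<close> has norm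
  \<open>(2 + a + 2b)\<^sup>1\<^sup>/\<^sup>\<alpha>\<close>, so the distances from \<open>0\<close> to \<open>K = X\<^sup>d\<close>, \<open>X = A \<union> h(A \<union> 2A)\<close>, fill an interval.
  The set \<open>X\<close> is covered by \<open>3 \<cdot> 2\<^sup>k\<close> intervals of length \<open>4 \<cdot> 4\<^sup>-\<^sup>k\<close>, which bounds \<open>dim K\<close> from above
  and shows that \<open>X\<close> contains no interval.  Replacing base \<open>4\<close> by base \<open>2\<close> is a Hoelder map of
  exponent \<open>1/2\<close> from \<open>A\<^sup>d\<close> onto the unit cube, which bounds \<open>dim K\<close> from below.
\<close>

section \<open>Sums of distinct negative powers\<close>

text \<open>Digits are 0 or 1 in every base: base 2 gives binary expansions, base 4 the Cantor set
  \<open>A\<close> of the outline. Boolean sequences let both bases share their digits and form a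
  compact space.\<close>

definition digit_sum :: "real \<Rightarrow> (nat \<Rightarrow> bool) \<Rightarrow> real" where
  "digit_sum b e = (\<Sum>k. of_bool (e k) / b ^ Suc k)"

lemma digit_sum_sums:
  assumes "b > 1"
  shows "(\<lambda>k. of_bool (e k) / b ^ Suc k) sums digit_sum b e"
proof -
  have "summable (\<lambda>k. (1 / b) ^ Suc k)"
    using assms by (subst summable_Suc_iff) (simp add: summable_geometric)
  then have "summable (\<lambda>k. of_bool (e k) / b ^ Suc k)"
    by (rule summable_comparison_test') (use assms in \<open>auto simp: power_one_over\<close>)
  then show ?thesis
    unfolding digit_sum_def by (rule summable_sums)
qed

text \<open>Splitting off the leading digit expresses self-similarity; the flipping, covering and
  Hoelder arguments rest on it.\<close>

lemma digit_sum_rec: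
  assumes "b > 1"
  shows "digit_sum b e = (of_bool (e 0) + digit_sum b (e \<circ> Suc)) / b"
proof -
  have "(\<lambda>k. (of_bool ((e \<circ> Suc) k) / b ^ Suc k) / b) sums (digit_sum b (e \<circ> Suc) / b)"
    by (intro sums_divide digit_sum_sums assms)
  then have "(\<lambda>k. of_bool (e (Suc k)) / b ^ Suc (Suc k)) sums (digit_sum b (e \<circ> Suc) / b)"
    by (simp add: mult.commute)
  then have "(\<lambda>k. of_bool (e k) / b ^ Suc k) sums (digit_sum b (e \<circ> Suc) / b + of_bool (e 0) / b ^ Suc 0)"
    by (rule sums_Suc)
  from sums_unique2[OF digit_sum_sums[OF assms] this] show ?thesis
    by (simp add: add_divide_distrib)
qed

lemma digit_sum_nonneg: "b > 1 \<Longrightarrow> 0 \<le> digit_sum b e"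
  by (rule sums_le[OF _ sums_zero digit_sum_sums]) simp_all

lemma digit_sum_all:
  assumes "b > 1"
  shows "digit_sum b (\<lambda>_. True) = 1 / (b - 1)"
proof -
  \<comment> \<open>The constant sequence is its own shift, so the recursion becomes a linear
    equation for its value.\<close>
  have "digit_sum b (\<lambda>_. True) = (1 + digit_sum b (\<lambda>_. True)) / b"
    using digit_sum_rec[OF assms, of "\<lambda>_. True"] by (simp only: comp_def of_bool_eq)
  then show ?thesis
    using assms by (simp add: field_simps)
qed

lemma digit_sum_le:
  assumes "b > 1"
  shows "digit_sum b e \<le> 1 / (b - 1)"
proof -
  have "digit_sum b e \<le> digit_sum b (\<lambda>_. True)"
    by (rule sums_le[OF _ digit_sum_sums digit_sum_sums]) (use assms in \<open>simp_all add: divide_right_mono\<close>)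
  then show ?thesis
    by (simp add: digit_sum_all assms)
qed

lemma digit_sum_none: "digit_sum b (\<lambda>_. False) = 0"
  by (simp add: digit_sum_def)

section \<open>Topology and coverings of the digit sets\<close>

lemma compact_range_digit_sum:
  assumes "b > 1"
  shows "compact (range (digit_sum b))"
proof (rule compact_continuous_image)
  have "summable (\<lambda>k. (1 / b) ^ Suc k)"
    using assms by (subst summable_Suc_iff) (simp add: summable_geometric)
  \<comment> \<open>Uniform convergence carries continuity from the partial sums, which depend on
    finitely many digits, to the series.\<close>
  then have lim: "uniform_limit UNIV (\<lambda>n e. \<Sum>k<n. of_bool (e k) / b ^ Suc k) (digit_sum b) sequentially"
    unfolding digit_sum_def
    by (intro Weierstrass_m_test) (use assms in \<open>auto simp: power_one_over\<close>)
  have coord: "continuous_on UNIV (\<lambda>e :: nat \<Rightarrow> bool. of_bool (e k) :: real)" for k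
    by (rule continuous_on_compose2[of UNIV of_bool UNIV "\<lambda>e. e k"])
       (auto simp: continuous_on_open_vimage open_discrete continuous_on_product_coordinates)
  show "continuous_on UNIV (digit_sum b)"
    by (rule uniform_limit_theorem[OF _ lim])
       (use assms in \<open>auto intro!: always_eventually continuous_on_sum continuous_on_divide coord\<close>)
  \<comment> \<open>Tychonoff: a product of copies of the finite space \<open>bool\<close> is
    compact.\<close>
  have "compact_space (product_topology (\<lambda>_ :: nat. euclidean :: bool topology) UNIV)"
    by (intro compact_space_product_topology[THEN iffD2] disjI2 ballI)
       (simp add: compact_space_def finite_imp_compact)
  then show "compact (UNIV :: (nat \<Rightarrow> bool) set)"
    unfolding euclidean_product_topology compact_space_def by simp
qed

text \<open>Flipping digit \<open>k\<close> alone changes a single term of the series. With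
  \<open>k\<close> large this shows that no point of the digit set is isolated.\<close>

lemma digit_sum_flip:
  assumes "b > 1"
  shows "\<exists>e'. \<bar>digit_sum b e' - digit_sum b e\<bar> = 1 / b ^ Suc k"
proof (induction k arbitrary: e)
  case 0
  have "(e(0 := \<not> e 0)) \<circ> Suc = e \<circ> Suc"
    by auto
  then have "digit_sum b (e(0 := \<not> e 0)) - digit_sum b e = (of_bool (\<not> e 0) - of_bool (e 0)) / b"
    unfolding digit_sum_rec[OF assms, of "e(0 := \<not> e 0)"] digit_sum_rec[OF assms, of e]
    by (simp flip: diff_divide_distrib)
  moreover have "\<bar>(of_bool (\<not> e 0) - of_bool (e 0)) / b\<bar> = 1 / b ^ Suc 0"
    using assms by (simp add: abs_divide)
  ultimately have "\<bar>digit_sum b (e(0 := \<not> e 0)) - digit_sum b e\<bar> = 1 / b ^ Suc 0"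
    by (simp only:)
  then show ?case
    by blast
next
  case (Suc k)
  obtain e' where e': "\<bar>digit_sum b e' - digit_sum b (e \<circ> Suc)\<bar> = 1 / b ^ Suc k"
    using Suc by blast
  \<comment> \<open>Prepending the old leading digit to \<open>e'\<close> divides the change already
    obtained by \<open>b\<close>.\<close>
  have "case_nat (e 0) e' \<circ> Suc = e'"
    by auto
  then have "digit_sum b (case_nat (e 0) e') - digit_sum b e
      = (digit_sum b e' - digit_sum b (e \<circ> Suc)) / b"
    unfolding digit_sum_rec[OF assms, of "case_nat (e 0) e'"] digit_sum_rec[OF assms, of e]
    by (simp flip: diff_divide_distrib)
  then have "\<bar>digit_sum b (case_nat (e 0) e') - digit_sum b e\<bar> = (1 / b ^ Suc k) / \<bar>b\<bar>"
    unfolding e'[symmetric] by (simp only: abs_divide)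
  also have "\<dots> = 1 / b ^ Suc (Suc k)"
    using assms by simp
  finally show ?case
    by blast
qed

lemma islimpt_range_digit_sum:
  assumes "b > 1" "x \<in> range (digit_sum b)"
  shows "x islimpt range (digit_sum b)"
  unfolding islimpt_approachable
proof (intro allI impI)
  fix r :: real
  assume "r > 0"
  obtain e where e: "x = digit_sum b e"
    using assms by blast
  obtain k where k: "(1 / b) ^ k < r"
    using real_arch_pow_inv[of r "1 / b"] \<open>r > 0\<close> assms by auto
  obtain e' where e': "\<bar>digit_sum b e' - digit_sum b e\<bar> = 1 / b ^ Suc k"
    using digit_sum_flip[OF assms(1)] by blast
  have "1 / b ^ Suc k \<le> (1 / b) ^ k"
    using assms by (simp add: power_one_over field_simps)
  moreover have "1 / b ^ Suc k > 0"
    using assms by simp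
  ultimately show "\<exists>x'\<in>range (digit_sum b). x' \<noteq> x \<and> dist x' x < r"
    using e e' k by (intro bexI[of _ "digit_sum b e'"]) (auto simp: dist_real_def)
qed

text \<open>The digit set is the union of its images under \<open>p / b\<close> and
  \<open>(1 + p) / b\<close>, so each level doubles the number of centres and divides the radius by
  \<open>b\<close>. Centres stay in the set and hence are nonnegative, as
  \<open>branch_lipschitz\<close> will require.\<close>

lemma range_digit_sum_finite_cover:
  assumes "b \<ge> 2"
  shows "\<exists>F. finite F \<and> F \<subseteq> range (digit_sum b) \<and> card F \<le> 2 ^ k
      \<and> (\<forall>a\<in>range (digit_sum b). \<exists>p\<in>F. \<bar>a - p\<bar> \<le> 1 / b ^ k)"
proof (induction k)
  case 0
  \<comment> \<open>A single centre 0 suffices: the set lies in \<open>[0, 1 / (b - 1)]\<close>, and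
    \<open>b \<ge> 2\<close>.\<close>
  have "\<bar>digit_sum b e - digit_sum b (\<lambda>_. False)\<bar> \<le> 1" for e
  proof -
    have "1 / (b - 1) \<le> 1"
      using assms by simp
    then show ?thesis
      using digit_sum_nonneg[of b e] digit_sum_le[of b e] assms
      unfolding digit_sum_none by linarith
  qed
  then show ?case
    by (intro exI[of _ "{digit_sum b (\<lambda>_. False)}"]) auto
next
  case (Suc k)
  then obtain F where F: "finite F" "F \<subseteq> range (digit_sum b)" "card F \<le> 2 ^ k"
    and cov: "\<And>e. \<exists>p\<in>F. \<bar>digit_sum b e - p\<bar> \<le> 1 / b ^ k"
    by auto
  define G where "G = (\<lambda>p. p / b) ` F \<union> (\<lambda>p. (1 + p) / b) ` F"
  have shift: "(of_bool c + digit_sum b e) / b \<in> range (digit_sum b)" for c e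
  proof -
    have "case_nat c e \<circ> Suc = e"
      by auto
    then have "digit_sum b (case_nat c e) = (of_bool c + digit_sum b e) / b"
      using assms by (simp add: digit_sum_rec[of b "case_nat c e"])
    then show ?thesis
      by (metis rangeI)
  qed
  have "finite G"
    using F by (simp add: G_def)
  moreover have "G \<subseteq> range (digit_sum b)"
    using F(2) shift[of False] shift[of True] by (fastforce simp: G_def)
  moreover have "card G \<le> 2 ^ Suc k"
    unfolding G_def
    using F(3) card_Un_le[of "(\<lambda>p. p / b) ` F" "(\<lambda>p. (1 + p) / b) ` F"]
      card_image_le[OF F(1), of "\<lambda>p. p / b"] card_image_le[OF F(1), of "\<lambda>p. (1 + p) / b"]
    by simp
  moreover have "\<exists>p\<in>G. \<bar>digit_sum b e - p\<bar> \<le> 1 / b ^ Suc k" for e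
  proof -
    obtain p where p: "p \<in> F" "\<bar>digit_sum b (e \<circ> Suc) - p\<bar> \<le> 1 / b ^ k"
      using cov by blast
    have "(of_bool (e 0) + p) / b \<in> G"
      using p(1) by (auto simp: G_def)
    moreover have "digit_sum b e - (of_bool (e 0) + p) / b = (digit_sum b (e \<circ> Suc) - p) / b"
      using assms by (simp add: digit_sum_rec[of b e] flip: diff_divide_distrib)
    then have "\<bar>digit_sum b e - (of_bool (e 0) + p) / b\<bar> \<le> 1 / b ^ Suc k"
      using p(2) assms by (simp add: abs_divide field_simps)
    ultimately show ?thesis
      by blast
  qed
  ultimately show ?case
    by blast
qed

lemma digit_sum_2_4_hoelder:
  "(digit_sum 2 e - digit_sum 2 e')\<^sup>2 \<le> 6 * \<bar>digit_sum 4 e - digit_sum 4 e'\<bar>"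
proof (cases "e = e'")
  case False
  have first: "(digit_sum 2 e - digit_sum 2 e')\<^sup>2 \<le> 6 * \<bar>digit_sum 4 e - digit_sum 4 e'\<bar>"
    if "e 0 \<noteq> e' 0" for e e'
  proof -
    have bounds: "0 \<le> digit_sum 4 f" "digit_sum 4 f \<le> 1 / 3"
      "0 \<le> digit_sum 2 f" "digit_sum 2 f \<le> 1" for f
      using digit_sum_nonneg[of 4 f] digit_sum_le[of 4 f]
        digit_sum_nonneg[of 2 f] digit_sum_le[of 2 f] by simp_all
    \<comment> \<open>Base 4 tails lie in \<open>[0, 1/3]\<close>, so different leading digits leave
      a gap of at least \<open>(1 - 1/3) / 4 = 1/6\<close>; this is the source of the constant
      6.\<close>
    have "1 / 6 \<le> \<bar>digit_sum 4 e - digit_sum 4 e'\<bar>"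
      using that bounds(1,2)[of "e \<circ> Suc"] bounds(1,2)[of "e' \<circ> Suc"]
        digit_sum_rec[of 4 e] digit_sum_rec[of 4 e']
      by (cases "e 0") (simp_all add: add_divide_distrib)
    moreover have "\<bar>digit_sum 2 e - digit_sum 2 e'\<bar> \<le> 1"
      using bounds(3,4)[of e] bounds(3,4)[of e'] by simp
    then have "(digit_sum 2 e - digit_sum 2 e')\<^sup>2 \<le> 1"
      by (simp add: abs_square_le_1)
    ultimately show ?thesis
      by simp
  qed
  from False obtain k where "e k \<noteq> e' k"
    by blast
  then show ?thesis
  \<comment> \<open>Here \<open>k\<close> is any position of disagreement, not necessarily the
    first: the induction stops early once the leading digits differ.\<close>
  proof (induction k arbitrary: e e')
    case 0
    then show ?case
      by (rule first)
  next
    case (Suc k)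
    show ?case
    proof (cases "e 0 = e' 0")
      case False
      then show ?thesis
        by (rule first)
    next
      case True
      \<comment> \<open>Differences scale by 1/2 in base 2 and by 1/4 in base 4, so both sides of
        the squared bound scale by 1/4.\<close>
      have "digit_sum b e - digit_sum b e' = (digit_sum b (e \<circ> Suc) - digit_sum b (e' \<circ> Suc)) / b"
        if "b > 1" for b
        using True that
        by (simp add: digit_sum_rec[of b e] digit_sum_rec[of b e'] flip: diff_divide_distrib)
      moreover have "(digit_sum 2 (e \<circ> Suc) - digit_sum 2 (e' \<circ> Suc))\<^sup>2
          \<le> 6 * \<bar>digit_sum 4 (e \<circ> Suc) - digit_sum 4 (e' \<circ> Suc)\<bar>"
        using Suc by simp
      ultimately show ?thesis
        by (simp add: power_divide abs_divide)
    qed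
  qed
qed simp

section \<open>Binary expansions and their splitting into two base 4 sums\<close>

lemma range_digit_sum_2: "range (digit_sum 2) = {0..1}"
proof
  show "range (digit_sum 2) \<subseteq> {0..1}"
    using digit_sum_nonneg[of 2] digit_sum_le[of 2] by auto
  show "{0..1} \<subseteq> range (digit_sum 2)"
  proof
    fix x :: real
    assume x: "x \<in> {0..1}"
    show "x \<in> range (digit_sum 2)"
    \<comment> \<open>At \<open>x = 1\<close> the floors used below are all even and would produce
      the digits of 0; the all-ones sequence is taken instead.\<close>
    proof (cases "x = 1")
      case True
      then show ?thesis
        using digit_sum_all[of 2] by (auto intro!: image_eqI[of _ _ "\<lambda>_. True"])
    next
      case False
      \<comment> \<open>With these parities as digits, the partial sums are the dyadic truncations
        of \<open>x\<close>.\<close>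
      define e where "e k = odd \<lfloor>2 ^ Suc k * x\<rfloor>" for k
      have part: "(\<Sum>k<n. of_bool (e k) / 2 ^ Suc k) = real_of_int \<lfloor>2 ^ n * x\<rfloor> / 2 ^ n" for n
      proof (induction n)
        case 0
        have "\<lfloor>x\<rfloor> = 0"
          using x False by (simp add: floor_eq_iff)
        then show ?case
          by simp
      next
        case (Suc n)
        have "\<lfloor>2 ^ n * x\<rfloor> = \<lfloor>2 ^ Suc n * x\<rfloor> div 2"
          using floor_divide_real_eq_div[of 2 "2 ^ Suc n * x"] by simp
        then have "\<lfloor>2 ^ Suc n * x\<rfloor> = 2 * \<lfloor>2 ^ n * x\<rfloor> + of_bool (e n)"
          unfolding e_def by (auto simp: odd_iff_mod_2_eq_one)
        then have "real_of_int \<lfloor>2 ^ Suc n * x\<rfloor> = 2 * real_of_int \<lfloor>2 ^ n * x\<rfloor> + of_bool (e n)"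
          by simp
        then show ?case
          unfolding sum.lessThan_Suc Suc.IH by (simp add: field_simps)
      qed
      have "(\<lambda>n. of_int \<lfloor>2 ^ n * x\<rfloor> / 2 ^ n) \<longlonglongrightarrow> x"
      proof (rule tendsto_sandwich[of "\<lambda>n. x - (1/2) ^ n" _ _ "\<lambda>_. x"])
        show "(\<lambda>n. x - (1/2) ^ n) \<longlonglongrightarrow> x"
          using tendsto_diff[OF tendsto_const LIMSEQ_power_zero[of "1/2 :: real"]] by simp
        have "x - (1/2) ^ n \<le> of_int \<lfloor>2 ^ n * x\<rfloor> / 2 ^ n" for n
          using divide_right_mono[of "2 ^ n * x - 1" "of_int \<lfloor>2 ^ n * x\<rfloor>" "2 ^ n"]
            floor_correct[of "2 ^ n * x"]
          by (simp add: diff_divide_distrib power_one_over)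
        then show "\<forall>\<^sub>F n in sequentially. x - (1/2) ^ n \<le> of_int \<lfloor>2 ^ n * x\<rfloor> / 2 ^ n"
          by simp
        have "of_int \<lfloor>2 ^ n * x\<rfloor> / 2 ^ n \<le> x" for n
          using floor_correct[of "2 ^ n * x"] by (simp add: field_simps)
        then show "\<forall>\<^sub>F n in sequentially. of_int \<lfloor>2 ^ n * x\<rfloor> / 2 ^ n \<le> x"
          by simp
      qed simp
      then have "(\<lambda>k. of_bool (e k) / 2 ^ Suc k) sums x"
        unfolding sums_def part .
      then have "x = digit_sum 2 e"
        by (rule sums_unique2[OF _ digit_sum_sums]) simp
      then show ?thesis
        by blast
    qed
  qed
qed

text \<open>Digits are indexed from 0, so index \<open>2 * k\<close> has weight
  \<open>2 / 4 ^ Suc k\<close> and index \<open>2 * k + 1\<close> has weight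
  \<open>1 / 4 ^ Suc k\<close>. Together with the binary expansions this gives
  \<open>A + 2A = [0,1]\<close>.\<close>

lemma digit_sum_2_split:
  "digit_sum 2 e = digit_sum 4 (\<lambda>k. e (2 * k + 1)) + 2 * digit_sum 4 (\<lambda>k. e (2 * k))"
proof -
  have "(\<lambda>k. 2 * (of_bool (e (2 * k)) / 4 ^ Suc k)) sums (2 * digit_sum 4 (\<lambda>k. e (2 * k)))"
    by (intro sums_mult digit_sum_sums) simp
  moreover have "(\<lambda>k. of_bool (e (2 * k + 1)) / 4 ^ Suc k) sums digit_sum 4 (\<lambda>k. e (2 * k + 1))"
    by (intro digit_sum_sums) simp
  ultimately have "(\<lambda>n. if even n then 2 * (of_bool (e (2 * (n div 2))) / 4 ^ Suc (n div 2))
        else of_bool (e (2 * ((n - 1) div 2) + 1)) / 4 ^ Suc ((n - 1) div 2))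
      sums (digit_sum 4 (\<lambda>k. e (2 * k + 1)) + 2 * digit_sum 4 (\<lambda>k. e (2 * k)))"
    by (rule sums_if[rotated])
  moreover have "(\<lambda>n. if even n then 2 * (of_bool (e (2 * (n div 2))) / 4 ^ Suc (n div 2))
        else of_bool (e (2 * ((n - 1) div 2) + 1)) / 4 ^ Suc ((n - 1) div 2))
      = (\<lambda>n. of_bool (e n) / 2 ^ Suc n :: real)"
  proof
    fix n
    have four: "(4 :: real) ^ m = 2 ^ (2 * m)" for m
      by (simp add: power_mult)
    show "(if even n then 2 * (of_bool (e (2 * (n div 2))) / 4 ^ Suc (n div 2))
        else of_bool (e (2 * ((n - 1) div 2) + 1)) / 4 ^ Suc ((n - 1) div 2))
      = (of_bool (e n) / 2 ^ Suc n :: real)"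
      unfolding four by (cases "even n") (auto elim!: evenE oddE)
  qed
  ultimately show ?thesis
    by (simp add: sums_unique2[OF digit_sum_sums[of 2 e]])
qed

section \<open>Hausdorff measure estimates\<close>

text \<open>The \<open>k\<close>-th family of balls is itself an admissible cover for large
  \<open>k\<close>, and its Hausdorff sum is at most the quantity assumed to tend to 0.\<close>

lemma hausdorff_measure_eq_0I:
  fixes A :: "'a::metric_space set"
  assumes fin: "\<And>k. finite (F k)"
    and cov: "\<And>k :: nat. A \<subseteq> (\<Union>p\<in>F k. cball p (r k))"
    and r: "\<And>k. 0 \<le> r k" "r \<longlonglongrightarrow> 0"
    and lim: "(\<lambda>k. real (card (F k)) * (2 * r k) powr s) \<longlonglongrightarrow> 0"
    and s: "s > 0"
  shows "hausdorff_measure s A = 0"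
proof -
  have "hausdorff_premeasure s \<delta> A = 0" if "\<delta> > 0" for \<delta>
  proof -
    have small: "hausdorff_premeasure s \<delta> A \<le> ennreal \<epsilon>" if "\<epsilon> > 0" for \<epsilon>
    proof -
      have "(\<lambda>k. 2 * r k) \<longlonglongrightarrow> 0"
        using tendsto_mult_right_zero[OF r(2)] .
      then have "\<forall>\<^sub>F k in sequentially. 2 * r k < \<delta>"
        using \<open>\<delta> > 0\<close> by (rule order_tendstoD)
      moreover have "\<forall>\<^sub>F k in sequentially. real (card (F k)) * (2 * r k) powr s < \<epsilon>"
        using lim \<open>\<epsilon> > 0\<close> by (rule order_tendstoD)
      ultimately have "\<forall>\<^sub>F k in sequentially. 2 * r k < \<delta> \<and> real (card (F k)) * (2 * r k) powr s < \<epsilon>"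
        by (rule eventually_conj)
      then obtain k where k: "2 * r k < \<delta>" "real (card (F k)) * (2 * r k) powr s < \<epsilon>"
        using eventually_happens'[OF sequentially_bot] by blast
      obtain f where f: "bij_betw f {0..<card (F k)} (F k)"
        using ex_bij_betw_nat_finite[OF fin] by blast
      \<comment> \<open>The finite family is padded to a sequence by empty sets, which contribute
        0.\<close>
      define U where "U i = (if i < card (F k) then cball (f i) (r k) else {})" for i
      have diam: "diameter (U i) \<le> 2 * r k" for i
      proof (cases "i < card (F k)")
        case True
        have "dist x y \<le> 2 * r k" if "x \<in> cball (f i) (r k)" "y \<in> cball (f i) (r k)" for x y
          using that dist_triangle3[of x y "f i"] by auto
        then show ?thesis
          using True r(1)[of k] by (auto simp: U_def diameter_def intro!: cSUP_least)
      qed (use r(1)[of k] in \<open>simp add: U_def\<close>)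
      have "A \<subseteq> (\<Union>i. U i)"
      proof
        fix x
        assume "x \<in> A"
        then obtain p where "p \<in> F k" "x \<in> cball p (r k)"
          using cov by blast
        moreover have "p \<in> f ` {0..<card (F k)}"
          using \<open>p \<in> F k\<close> bij_betw_imp_surj_on[OF f] by simp
        then obtain i where "i < card (F k)" "p = f i"
          by auto
        ultimately show "x \<in> (\<Union>i. U i)"
          by (intro UN_I[of i]) (auto simp: U_def)
      qed
      moreover have bounded: "bounded (U i)" for i
        by (simp add: U_def)
      ultimately have "hausdorff_premeasure s \<delta> A \<le> (\<Sum>i. diam_pow s (U i))"
        unfolding hausdorff_premeasure_def
        using order_trans[OF diam less_imp_le[OF k(1)]] by (intro INF_lower) simp
      also have "\<dots> = (\<Sum>i<card (F k). diam_pow s (U i))"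
        by (intro suminf_finite) (auto simp: U_def diam_pow_def)
      also have "\<dots> \<le> (\<Sum>i<card (F k). ennreal ((2 * r k) powr s))"
      proof (rule sum_mono)
        fix i
        have "diameter (U i) powr s \<le> (2 * r k) powr s"
          using s by (intro powr_mono2 diam diameter_ge_0 bounded) simp
        then show "diam_pow s (U i) \<le> ennreal ((2 * r k) powr s)"
          using s by (simp add: diam_pow_def ennreal_leI)
      qed
      also have "\<dots> = ennreal (real (card (F k)) * (2 * r k) powr s)"
        by (simp add: ennreal_mult ennreal_of_nat_eq_real_of_nat)
      also have "\<dots> \<le> ennreal \<epsilon>"
        using k(2) by (intro ennreal_leI) simp
      finally show ?thesis .
    qed
    have "hausdorff_premeasure s \<delta> A \<le> 0"
    proof (rule ennreal_le_epsilon)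
      fix \<epsilon> :: real
      assume "0 < \<epsilon>"
      then show "hausdorff_premeasure s \<delta> A \<le> 0 + ennreal \<epsilon>"
        using small by simp
    qed
    then show ?thesis
      by simp
  qed
  then show ?thesis
    by (simp add: hausdorff_measure_def)
qed

text \<open>A set of diameter \<open>\<delta> \<le> 1\<close> is mapped into a box of volume at most
  a constant times \<open>\<delta> powr s\<close>. A cover with too small a Hausdorff sum would thus
  cover the unit cube by boxes of total volume below 1. Working on a subset \<open>D\<close> of
  \<open>A\<close> builds in monotonicity.\<close>

lemma hausdorff_measure_neq_0I:
  fixes f :: "'a::metric_space \<Rightarrow> real ^ 'n"
  assumes hoelder: "\<And>x y i. x \<in> D \<Longrightarrow> y \<in> D \<Longrightarrow> (f x $ i - f y $ i)\<^sup>2 \<le> C * dist x y"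
    and C: "C > 0" and D: "D \<subseteq> A" and cube: "cbox 0 1 \<subseteq> f ` D"
    and s: "0 \<le> s" "s < real CARD('n) / 2"
  shows "hausdorff_measure s A \<noteq> 0"
proof
  assume "hausdorff_measure s A = 0"
  moreover have "hausdorff_premeasure s 1 A \<le> hausdorff_measure s A"
    unfolding hausdorff_measure_def by (rule SUP_upper) simp
  ultimately have pre0: "hausdorff_premeasure s 1 A = 0"
    by simp
  \<comment> \<open>A box of half side \<open>sqrt (C * \<delta>)\<close> has volume
    \<open>c\<close> times \<open>\<delta> powr (n / 2)\<close>, where \<open>n\<close> is the
    number of coordinates.\<close>
  define c where "c = (2 * sqrt C) ^ CARD('n)"
  have c: "c > 0"
    using C by (simp add: c_def)
  have "hausdorff_premeasure s 1 A < ennreal (1 / c)"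
    using c pre0 by simp
  then obtain U :: "nat \<Rightarrow> 'a set" where U: "A \<subseteq> (\<Union>i. U i)" "\<And>i. bounded (U i)" "\<And>i. diameter (U i) \<le> 1"
    and sum: "(\<Sum>i. diam_pow s (U i)) < ennreal (1 / c)"
    unfolding hausdorff_premeasure_def by (auto simp: INF_less_iff)
  \<comment> \<open>The images need not be measurable, so each is enclosed in a box, or in the empty
    set when \<open>U i\<close> misses \<open>D\<close>.\<close>
  have "\<exists>B. B \<in> sets lborel \<and> f ` (U i \<inter> D) \<subseteq> B \<and> emeasure lborel B \<le> ennreal c * diam_pow s (U i)" for i
  proof (cases "U i \<inter> D = {}")
    case False
    then obtain x where x: "x \<in> U i" "x \<in> D"
      by blast
    define t where "t = sqrt (C * diameter (U i))"
    have diam: "0 \<le> diameter (U i)"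
      by (intro diameter_ge_0 U)
    define B where "B = cbox (f x - vec t) (f x + vec t)"
    have "f y \<in> B" if "y \<in> U i" "y \<in> D" for y
    proof -
      have "\<bar>f y $ j - f x $ j\<bar> \<le> t" for j
      proof -
        have "dist y x \<le> diameter (U i)"
          by (intro diameter_bounded_bound U that x)
        then have "(f y $ j - f x $ j)\<^sup>2 \<le> C * diameter (U i)"
          using hoelder[OF \<open>y \<in> D\<close> \<open>x \<in> D\<close>, of j] C
          by (meson less_imp_le mult_left_mono order_trans)
        then have "sqrt ((f y $ j - f x $ j)\<^sup>2) \<le> t"
          unfolding t_def by (rule real_sqrt_le_mono)
        then show ?thesis
          by simp
      qed
      then show ?thesis
        by (auto simp: B_def mem_box_cart abs_le_iff algebra_simps)
    qed
    moreover have "emeasure lborel B \<le> ennreal c * diam_pow s (U i)"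
    proof -
      have t: "t \<ge> 0"
        using C diam by (simp add: t_def)
      have inner: "vec t \<bullet> b = t" if "b \<in> Basis" for b :: "real ^ 'n"
        using that by (auto simp: Basis_vec_def inner_axis)
      have "emeasure lborel B
          = ennreal (\<Prod>b\<in>Basis. (f x + vec t - (f x - vec t)) \<bullet> b)"
        unfolding B_def using t
        by (intro emeasure_lborel_cbox) (simp add: inner inner_add_left inner_diff_left)
      also have "(\<Prod>b\<in>Basis. (f x + vec t - (f x - vec t)) \<bullet> b)
          = (\<Prod>b\<in>(Basis :: (real ^ 'n) set). 2 * t)"
        by (intro prod.cong refl) (simp only: inner inner_add_left inner_diff_left algebra_simps)
      also have "\<dots> = ennreal ((2 * t) ^ CARD('n))"
        by simp
      also have "(2 * t) ^ CARD('n) = c * sqrt (diameter (U i)) ^ CARD('n)"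
        by (simp add: t_def c_def real_sqrt_mult power_mult_distrib)
      also have "\<dots> = c * diameter (U i) powr (real CARD('n) / 2)"
      proof (cases "diameter (U i) = 0")
        case False
        then have "sqrt (diameter (U i)) ^ CARD('n) = diameter (U i) powr (1 / 2 * real CARD('n))"
          using diam by (simp add: powr_half_sqrt[symmetric] powr_realpow[symmetric] powr_powr)
        then show ?thesis
          by simp
      qed simp
      also have "ennreal \<dots> = ennreal c * ennreal (diameter (U i) powr (real CARD('n) / 2))"
        using c by (simp add: ennreal_mult)
      \<comment> \<open>As the diameter is at most 1, lowering the exponent can only increase the
        power. For \<open>s = 0\<close> the convention \<open>0^0 = 1\<close> calls for a separate
        argument.\<close>
      also have "ennreal (diameter (U i) powr (real CARD('n) / 2)) \<le> diam_pow s (U i)"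
      proof (cases "s = 0")
        case True
        then show ?thesis
          using x U(3)[of i] diam powr_mono2[of "real CARD('n) / 2" "diameter (U i)" 1]
          by (auto simp: diam_pow_def)
      next
        case False
        then show ?thesis
          using x s U(3)[of i] diam by (auto simp: diam_pow_def intro!: ennreal_leI powr_mono')
      qed
      finally show ?thesis
        by (simp add: mult_left_mono)
    qed
    ultimately show ?thesis
      by (intro exI[of _ B]) (auto simp: B_def)
  qed (auto intro!: exI[of _ "{}"])
  then obtain B where B: "\<And>i. B i \<in> sets lborel" "\<And>i. f ` (U i \<inter> D) \<subseteq> B i"
    "\<And>i. emeasure lborel (B i) \<le> ennreal c * diam_pow s (U i)"
    by metis
  have "1 \<bullet> b = 1" if "b \<in> Basis" for b :: "real ^ 'n"
    using that by (auto simp: Basis_vec_def inner_axis)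
  then have "emeasure lborel (cbox 0 1 :: (real ^ 'n) set) = 1"
    by (subst emeasure_lborel_cbox) simp_all
  then have "1 = emeasure lborel (cbox 0 1 :: (real ^ 'n) set)"
    by simp
  also have "\<dots> \<le> emeasure lborel (\<Union>i. B i)"
  proof (rule emeasure_mono)
    show "cbox 0 1 \<subseteq> (\<Union>i. B i)"
    proof
      fix y :: "real ^ 'n"
      assume "y \<in> cbox 0 1"
      then obtain x where x: "x \<in> D" "y = f x"
        using cube by blast
      then obtain i where "x \<in> U i"
        using D U(1) by blast
      with x have "y \<in> B i"
        using B(2)[of i] by blast
      then show "y \<in> (\<Union>i. B i)"
        by blast
    qed
  qed (use B(1) in auto)
  also have "\<dots> \<le> (\<Sum>i. emeasure lborel (B i))"
    by (intro emeasure_subadditive_countably) (use B(1) in auto)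
  also have "\<dots> \<le> (\<Sum>i. ennreal c * diam_pow s (U i))"
    by (intro suminf_le B) auto
  also have "\<dots> = ennreal c * (\<Sum>i. diam_pow s (U i))"
    by simp
  also have "\<dots> < ennreal c * ennreal (1 / c)"
    using sum c by (intro ennreal_mult_strict_left_mono) auto
  also have "\<dots> = 1"
    using c by (simp flip: ennreal_mult)
  finally show False
    by simp
qed

lemma hausdorff_dim_eqI:
  assumes "d \<ge> 0"
    and upper: "\<And>s. s > d \<Longrightarrow> hausdorff_measure s A = 0"
    and lower: "\<And>s. 0 \<le> s \<Longrightarrow> s < d \<Longrightarrow> hausdorff_measure s A \<noteq> 0"
  shows "hausdorff_dim A = ennreal d"
proof (rule antisym)
  show "hausdorff_dim A \<le> ennreal d"
  \<comment> \<open>Nothing is known at the exponent \<open>d\<close> itself, so it is approached by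
    \<open>d + e\<close>.\<close>
  proof (rule ennreal_le_epsilon)
    fix e :: real
    assume "e > 0"
    then have "hausdorff_dim A \<le> ennreal (d + e)"
      unfolding hausdorff_dim_def using \<open>d \<ge> 0\<close> by (intro INF_lower) (simp add: upper)
    then show "hausdorff_dim A \<le> ennreal d + ennreal e"
      using \<open>e > 0\<close> \<open>d \<ge> 0\<close> by (subst ennreal_plus[symmetric]) auto
  qed
  show "ennreal d \<le> hausdorff_dim A"
    unfolding hausdorff_dim_def
  proof (rule INF_greatest)
    fix s
    assume "s \<in> {s. 0 \<le> s \<and> hausdorff_measure s A = 0}"
    then have "d \<le> s"
      using lower[of s] by (cases "d \<le> s") auto
    then show "ennreal d \<le> ennreal s"
      by (rule ennreal_leI)
  qed
qed

section \<open>Cubes over a subset of the line\<close>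

definition vec_cube :: "'a set \<Rightarrow> ('a ^ 'n) set" where
  "vec_cube X = {x. \<forall>i. x $ i \<in> X}"

lemma compact_vec_cube:
  fixes X :: "real set"
  assumes "compact X"
  shows "compact (vec_cube X :: (real ^ 'n) set)"
  unfolding compact_eq_bounded_closed
proof
  have "closed ((\<lambda>x :: real ^ 'n. x $ i) -` X)" for i
    using assms by (intro closed_vimage continuous_on_component continuous_on_id compact_imp_closed)
  then have "closed (\<Inter>i. (\<lambda>x :: real ^ 'n. x $ i) -` X)"
    by blast
  also have "(\<Inter>i. (\<lambda>x :: real ^ 'n. x $ i) -` X) = vec_cube X"
    by (auto simp: vec_cube_def)
  finally show "closed (vec_cube X :: (real ^ 'n) set)" .
  obtain B where B: "\<And>x. x \<in> X \<Longrightarrow> \<bar>x\<bar> \<le> B"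
    using compact_imp_bounded[OF assms] by (auto simp: bounded_iff)
  have "norm x \<le> of_nat CARD('n) * B" if "x \<in> vec_cube X" for x :: "real ^ 'n"
    using norm_le_l1_cart[of x] sum_bounded_above[of UNIV "\<lambda>i. \<bar>x $ i\<bar>" B] that B
    by (force simp: vec_cube_def)
  then show "bounded (vec_cube X :: (real ^ 'n) set)"
    by (auto simp: bounded_iff)
qed

lemma islimpt_vec_cube:
  fixes X :: "real set"
  assumes "\<And>x. x \<in> X \<Longrightarrow> x islimpt X" and "x \<in> vec_cube X"
  shows "x islimpt (vec_cube X :: (real ^ 'n) set)"
  unfolding islimpt_approachable
proof (intro allI impI)
  fix r :: real
  assume "r > 0"
  \<comment> \<open>Moving one coordinate is enough, and any coordinate will do.\<close>
  fix i :: 'n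
  obtain y where y: "y \<in> X" "y \<noteq> x $ i" "dist y (x $ i) < r"
    using assms \<open>r > 0\<close> unfolding vec_cube_def islimpt_approachable by blast
  define z where "z = (\<chi> j. if j = i then y else x $ j)"
  have "z - x = (y - x $ i) *\<^sub>R axis i 1"
    by (auto simp: z_def vec_eq_iff axis_def)
  then have "dist z x < r"
    using y(3) by (simp add: dist_norm norm_axis_1)
  moreover have "z $ i \<noteq> x $ i"
    using y(2) by (simp add: z_def)
  moreover have "z \<in> vec_cube X"
    using assms(2) y(1) by (auto simp: z_def vec_cube_def)
  ultimately show "\<exists>z\<in>vec_cube X. z \<noteq> x \<and> dist z x < r"
    by (intro bexI[of _ z] conjI) auto
qed

text \<open>Each coordinate projects a connected component onto a connected subset of
  \<open>X\<close>; since \<open>X\<close> contains no interval, that projection is a single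
  point.\<close>

lemma totally_disconnected_vec_cube:
  fixes X :: "real set"
  assumes "\<And>x y. x < y \<Longrightarrow> \<not> {x..y} \<subseteq> X"
  shows "totally_disconnected (vec_cube X :: (real ^ 'n) set)"
  unfolding totally_disconnected_def
proof
  fix x :: "real ^ 'n"
  assume x: "x \<in> vec_cube X"
  define S where "S = connected_component_set (vec_cube X) x"
  have S: "connected S" "x \<in> S" "S \<subseteq> vec_cube X"
    using x connected_component_subset by (auto simp: S_def)
  have eq: "u $ i \<le> v $ i" if "u \<in> S" "v \<in> S" for u v i
  proof (rule ccontr)
    assume less: "\<not> u $ i \<le> v $ i"
    have "connected ((\<lambda>w. w $ i) ` S)"
      using S(1) by (intro connected_continuous_image continuous_on_component continuous_on_id)
    then have "{v $ i..u $ i} \<subseteq> (\<lambda>w. w $ i) ` S"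
      using that by (intro connected_contains_Icc) auto
    also have "\<dots> \<subseteq> X"
      using S(3) by (auto simp: vec_cube_def)
    finally show False
      using assms less by force
  qed
  then have "u = x" if "u \<in> S" for u
    using eq[OF that S(2)] eq[OF S(2) that] by (simp add: vec_eq_iff antisym)
  then have "S = {x}"
    using S(2) by blast
  then show "connected_component_set (vec_cube X) x = {x}"
    by (simp add: S_def)
qed

text \<open>The centres form the product grid; the factor \<open>CARD('n)\<close> in the radius
  comes from bounding the Euclidean norm by the sum of the absolute coordinates.\<close>

lemma vec_cube_finite_cover:
  fixes X F :: "real set"
  assumes "finite F" and "X \<subseteq> (\<Union>p\<in>F. cball p r)"
  shows "finite (vec_cube F :: (real ^ 'n) set)"
    and "card (vec_cube F :: (real ^ 'n) set) \<le> card F ^ CARD('n)"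
    and "vec_cube X \<subseteq> (\<Union>p \<in> (vec_cube F :: (real ^ 'n) set). cball p (real CARD('n) * r))"
proof -
  have sub: "vec_cube F \<subseteq> vec_lambda ` ((UNIV :: 'n set) \<rightarrow>\<^sub>E F)"
  proof
    fix x :: "real ^ 'n"
    assume "x \<in> vec_cube F"
    then show "x \<in> vec_lambda ` (UNIV \<rightarrow>\<^sub>E F)"
      by (intro image_eqI[of _ _ "vec_nth x"]) (auto simp: vec_cube_def)
  qed
  have fin: "finite ((UNIV :: 'n set) \<rightarrow>\<^sub>E F)"
    using assms(1) by (intro finite_PiE) auto
  show "finite (vec_cube F :: (real ^ 'n) set)"
    using sub fin by (meson finite_imageI finite_subset)
  show "card (vec_cube F :: (real ^ 'n) set) \<le> card F ^ CARD('n)"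
    using card_mono[OF finite_imageI[OF fin] sub] card_image_le[OF fin, of vec_lambda]
    by (simp add: card_funcsetE)
  show "vec_cube X \<subseteq> (\<Union>p \<in> (vec_cube F :: (real ^ 'n) set). cball p (real CARD('n) * r))"
  proof
    fix x :: "real ^ 'n"
    assume "x \<in> vec_cube X"
    then have "\<exists>p\<in>F. \<bar>p - x $ i\<bar> \<le> r" for i
      using assms(2) by (force simp: vec_cube_def dist_real_def)
    then obtain p where p: "\<And>i. p i \<in> F" "\<And>i. \<bar>p i - x $ i\<bar> \<le> r"
      by metis
    have "norm (vec_lambda p - x) \<le> real CARD('n) * r"
      using norm_le_l1_cart[of "vec_lambda p - x"]
        sum_bounded_above[of UNIV "\<lambda>i. \<bar>(vec_lambda p - x) $ i\<bar>" r] p(2) by force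
    moreover have "vec_lambda p \<in> vec_cube F"
      using p(1) by (simp add: vec_cube_def)
    ultimately show "x \<in> (\<Union>p \<in> vec_cube F. cball p (real CARD('n) * r))"
      by (auto simp: dist_norm)
  qed
qed

text \<open>The total length of the covers tends to 0, so \<open>X\<close> cannot contain a set of
  positive Lebesgue measure.\<close>

lemma Icc_not_subset_of_small_covers:
  fixes X :: "real set"
  assumes fin: "\<And>k. finite (F k)"
    and cov: "\<And>k :: nat. X \<subseteq> (\<Union>p\<in>F k. cball p (r k))"
    and r: "\<And>k. 0 \<le> r k"
    and lim: "(\<lambda>k. real (card (F k)) * (2 * r k)) \<longlonglongrightarrow> 0"
    and "x < y"
  shows "\<not> {x..y} \<subseteq> X"
proof
  assume sub: "{x..y} \<subseteq> X"
  have "y - x \<le> real (card (F k)) * (2 * r k)" for k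
  proof -
    have "ennreal (y - x) = emeasure lborel {x..y}"
      using \<open>x < y\<close> by simp
    also have "\<dots> \<le> emeasure lborel (\<Union>p\<in>F k. cball p (r k))"
    proof (rule emeasure_mono)
      show "{x..y} \<subseteq> (\<Union>p\<in>F k. cball p (r k))"
        using sub cov[of k] by (rule order_trans)
      show "(\<Union>p\<in>F k. cball p (r k)) \<in> sets lborel"
        using fin[of k] by (simp add: borel_closed closed_UN)
    qed
    also have "\<dots> \<le> (\<Sum>p\<in>F k. emeasure lborel (cball p (r k)))"
      using fin by (intro emeasure_subadditive_finite) auto
    also have "\<dots> = (\<Sum>p\<in>F k. ennreal (2 * r k))"
      using r[of k] by (simp add: cball_eq_atLeastAtMost)
    also have "\<dots> = ennreal (real (card (F k)) * (2 * r k))"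
      using r[of k] by (simp add: ennreal_mult ennreal_of_nat_eq_real_of_nat)
    finally show ?thesis
      using r[of k] by (subst (asm) ennreal_le_iff) auto
  qed
  then have "y - x \<le> 0"
    by (intro LIMSEQ_le_const[OF lim]) auto
  then show False
    using \<open>x < y\<close> by simp
qed

text \<open>Up to a constant this is a geometric sequence of ratio \<open>2 ^ n / 4 powr s\<close>,
  which is below 1 because \<open>s > n / 2\<close>.\<close>

lemma power_tendsto_0_dimension:
  fixes c :: real
  assumes "s > real n / 2" and "c \<ge> 0"
  shows "(\<lambda>k. real ((3 * 2 ^ k) ^ n) * (c / 4 ^ k) powr s) \<longlonglongrightarrow> 0"
proof -
  have "(4 :: real) powr s = 2 powr (2 * s)"
    using powr_powr[of 2 2 s] by (simp add: mult.commute)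
  moreover have "(2 :: real) ^ n = 2 powr real n"
    by (simp add: powr_realpow)
  ultimately have "(2 :: real) ^ n < 4 powr s"
    using assms by simp
  then have "(\<lambda>k. (2 ^ n / 4 powr s) ^ k) \<longlonglongrightarrow> (0 :: real)"
    by (intro LIMSEQ_power_zero) simp
  then have "(\<lambda>k. 3 ^ n * c powr s * (2 ^ n / 4 powr s) ^ k) \<longlonglongrightarrow> 0"
    by (rule tendsto_mult_right_zero)
  moreover have "real ((3 * 2 ^ k) ^ n) * (c / 4 ^ k) powr s
      = 3 ^ n * c powr s * (2 ^ n / 4 powr s) ^ k" for k
  proof -
    have "((4 :: real) ^ k) powr s = (4 powr s) ^ k"
      by (simp add: powr_powr powr_realpow[symmetric] powr_power mult.commute)
    moreover have "((2 :: real) ^ k) ^ n = (2 ^ n) ^ k"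
      by (simp add: power_mult[symmetric] mult.commute)
    ultimately show ?thesis
      using assms by (simp add: powr_divide power_mult_distrib power_divide)
  qed
  ultimately show ?thesis
    by (simp only:)
qed

section \<open>The Cantor set\<close>

text \<open>Its \<open>\<alpha>\<close>-th power is affine in \<open>a\<close>, which linearises the
  norm. The shift by 1 keeps the root away from 0, where it fails to be Lipschitz for
  \<open>\<alpha> > 1\<close>.\<close>

definition branch :: "real \<Rightarrow> real \<Rightarrow> real" where
  "branch \<alpha> a = (1 + a) powr (1 / \<alpha>)"

lemma branch_nonneg: "branch \<alpha> a \<ge> 0"
  by (simp add: branch_def)

lemma branch_powr: "\<alpha> > 0 \<Longrightarrow> a \<ge> 0 \<Longrightarrow> branch \<alpha> a powr \<alpha> = 1 + a"
  by (simp add: branch_def powr_powr)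

lemma inj_on_branch: "\<alpha> > 0 \<Longrightarrow> inj_on (branch \<alpha>) {0..}"
  using branch_powr by (intro inj_onI) (metis add_left_cancel atLeast_iff)

lemma continuous_on_branch: "continuous_on {0..} (branch \<alpha>)"
  unfolding branch_def by (intro continuous_intros) auto

text \<open>Write \<open>1 + b = (1 + a) * t\<close> with \<open>t \<ge> 1\<close>: as
  \<open>1 / \<alpha> \<le> 1\<close>, the roots of \<open>1 + a\<close> and \<open>t\<close> do not
  exceed these numbers. Hence \<open>branch\<close> does not enlarge covering radii.\<close>

lemma branch_lipschitz:
  assumes "\<alpha> \<ge> 1" "a \<ge> 0" "b \<ge> 0"
  shows "\<bar>branch \<alpha> a - branch \<alpha> b\<bar> \<le> \<bar>a - b\<bar>"
proof -
  have *: "branch \<alpha> b - branch \<alpha> a \<le> b - a \<and> branch \<alpha> a \<le> branch \<alpha> b" if "0 \<le> a" "a \<le> b" for a b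
  proof
    define t where "t = (1 + b) / (1 + a)"
    have t: "t \<ge> 1" "1 + b = (1 + a) * t"
      using that by (auto simp: t_def)
    have p: "1 / \<alpha> \<le> 1" "0 \<le> 1 / \<alpha>"
      using assms by auto
    have "t powr (1 / \<alpha>) \<le> t powr 1" "(1 + a) powr (1 / \<alpha>) \<le> (1 + a) powr 1"
      using powr_mono[OF p(1), of t] powr_mono[OF p(1), of "1 + a"] t(1) that(1) by simp_all
    moreover have "1 \<le> t powr (1 / \<alpha>)"
      using t p by (simp add: ge_one_powr_ge_zero)
    moreover have "((1 + a) * t) powr (1 / \<alpha>) = (1 + a) powr (1 / \<alpha>) * t powr (1 / \<alpha>)"
      by (rule powr_mult)
    then have "branch \<alpha> b - branch \<alpha> a = (1 + a) powr (1 / \<alpha>) * (t powr (1 / \<alpha>) - 1)"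
      unfolding branch_def t(2) by (simp add: right_diff_distrib)
    ultimately have "branch \<alpha> b - branch \<alpha> a \<le> (1 + a) * (t - 1)"
      using that t by (auto intro!: mult_mono)
    also have "\<dots> = b - a"
      using t(2) by (simp add: algebra_simps)
    finally show "branch \<alpha> b - branch \<alpha> a \<le> b - a" .
    show "branch \<alpha> a \<le> branch \<alpha> b"
      unfolding branch_def using that p by (intro powr_mono2) auto
  qed
  show ?thesis
    using *[of a b] *[of b a] assms by (cases "a \<le> b") auto
qed

text \<open>Continuity brings image points close to \<open>f x\<close>, and injectivity keeps them
  different from it.\<close>

lemma islimpt_inj_on_image:
  assumes "x islimpt S" "x \<in> S" "continuous_on S f" "inj_on f S"
  shows "f x islimpt f ` S"
proof (rule islimptI)
  fix T
  assume "f x \<in> T" "open T"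
  then obtain U where U: "open U" "x \<in> U" "\<And>y. y \<in> S \<Longrightarrow> y \<in> U \<Longrightarrow> f y \<in> T"
    using assms(2,3) unfolding continuous_on_topological by meson
  then obtain y where "y \<in> S" "y \<in> U" "y \<noteq> x"
    using assms(1) by (meson islimptE)
  then show "\<exists>y\<in>f ` S. y \<in> T \<and> y \<noteq> f x"
    using U(3) assms(2,4) by (auto dest: inj_onD)
qed

text \<open>The digit set supplies the coordinate 0 and the lower dimension bound; the two branch
  images supply the two nonzero coordinates of the points that realise the distances. Using the
  union as the factor in every coordinate makes the final set a plain power.\<close>

definition cantor_factor :: "real \<Rightarrow> real set" where
  "cantor_factor \<alpha> = range (digit_sum 4)
     \<union> branch \<alpha> ` (range (digit_sum 4) \<union> (*) 2 ` range (digit_sum 4))"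

lemma compact_cantor_factor: "compact (cantor_factor \<alpha>)"
proof -
  have A: "compact (range (digit_sum 4))"
    by (rule compact_range_digit_sum) simp
  moreover have "compact ((*) 2 ` range (digit_sum 4))"
    by (rule compact_continuous_image[OF _ A]) (intro continuous_intros)
  moreover have "continuous_on (range (digit_sum 4) \<union> (*) 2 ` range (digit_sum 4)) (branch \<alpha>)"
    by (rule continuous_on_subset[OF continuous_on_branch]) (auto simp: digit_sum_nonneg)
  ultimately show ?thesis
    unfolding cantor_factor_def using A by (metis compact_Un compact_continuous_image)
qed

lemma islimpt_cantor_factor:
  assumes "\<alpha> > 0" "x \<in> cantor_factor \<alpha>"
  shows "x islimpt cantor_factor \<alpha>"
proof -
  let ?A = "range (digit_sum 4)"
  let ?B = "?A \<union> (*) 2 ` ?A"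
  have A: "a islimpt ?A" if "a \<in> ?A" for a
    using that by (intro islimpt_range_digit_sum) auto
  have "2 * a islimpt (*) 2 ` ?A" if "a \<in> ?A" for a
    using A[OF that] that by (intro islimpt_inj_on_image) (auto intro!: continuous_intros inj_onI)
  then have B: "b islimpt ?B" if "b \<in> ?B" for b
    using A that by (auto simp: islimpt_Un)
  have "branch \<alpha> b islimpt branch \<alpha> ` ?B" if "b \<in> ?B" for b
  proof (rule islimpt_inj_on_image[OF B[OF that] that])
    have "?B \<subseteq> {0..}"
      by (auto simp: digit_sum_nonneg)
    then show "continuous_on ?B (branch \<alpha>)" "inj_on (branch \<alpha>) ?B"
      using continuous_on_branch inj_on_branch[OF assms(1)]
      by (blast intro: continuous_on_subset inj_on_subset)+
  qed
  then show ?thesis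
    using A assms(2) by (auto simp: cantor_factor_def islimpt_Un)
qed

text \<open>The three pieces each contribute one copy of the centres, hence the factor 3; doubling
  the digit set doubles the radius to \<open>2 / 4 ^ k\<close>.\<close>

lemma cantor_factor_finite_cover:
  assumes "\<alpha> \<ge> 1"
  shows "\<exists>F. finite F \<and> card F \<le> 3 * 2 ^ k \<and> cantor_factor \<alpha> \<subseteq> (\<Union>p\<in>F. cball p (2 / 4 ^ k))"
proof -
  obtain F where F: "finite F" "F \<subseteq> range (digit_sum 4)" "card F \<le> 2 ^ k"
    and cov: "\<And>e. \<exists>p\<in>F. \<bar>digit_sum 4 e - p\<bar> \<le> 1 / 4 ^ k"
    using range_digit_sum_finite_cover[of 4 k] by auto
  have nonneg: "p \<ge> 0" if "p \<in> F" for p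
    using F(2) that by (auto simp: digit_sum_nonneg)
  define G where "G = F \<union> (branch \<alpha> ` F \<union> (\<lambda>p. branch \<alpha> (2 * p)) ` F)"
  have "finite G"
    using F by (simp add: G_def)
  moreover have "card G \<le> card F + (card (branch \<alpha> ` F) + card ((\<lambda>p. branch \<alpha> (2 * p)) ` F))"
    unfolding G_def by (meson add_left_mono card_Un_le order_trans)
  then have "card G \<le> 3 * 2 ^ k"
    using F(3) card_image_le[OF F(1), of "branch \<alpha>"]
      card_image_le[OF F(1), of "\<lambda>p. branch \<alpha> (2 * p)"] by linarith
  moreover have "\<exists>p\<in>G. dist p x \<le> 2 / 4 ^ k" if "x \<in> cantor_factor \<alpha>" for x
  proof -
    have "\<exists>e. x = digit_sum 4 e \<or> x = branch \<alpha> (digit_sum 4 e) \<or> x = branch \<alpha> (2 * digit_sum 4 e)"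
      using that unfolding cantor_factor_def image_Un image_image by blast
    then obtain e where "x = digit_sum 4 e \<or> x = branch \<alpha> (digit_sum 4 e) \<or> x = branch \<alpha> (2 * digit_sum 4 e)"
      by blast
    moreover obtain p where p: "p \<in> F" "\<bar>digit_sum 4 e - p\<bar> \<le> 1 / 4 ^ k"
      using cov by blast
    moreover have "\<bar>branch \<alpha> (digit_sum 4 e) - branch \<alpha> p\<bar> \<le> \<bar>digit_sum 4 e - p\<bar>"
      using assms p nonneg by (intro branch_lipschitz) (auto simp: digit_sum_nonneg)
    moreover have "\<bar>branch \<alpha> (2 * digit_sum 4 e) - branch \<alpha> (2 * p)\<bar> \<le> \<bar>2 * digit_sum 4 e - 2 * p\<bar>"
      using assms p nonneg by (intro branch_lipschitz) (auto simp: digit_sum_nonneg)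
    moreover have "p \<in> G" "branch \<alpha> p \<in> G" "branch \<alpha> (2 * p) \<in> G"
      using p(1) by (auto simp: G_def)
    ultimately have "\<exists>p\<in>G. \<bar>x - p\<bar> \<le> 2 * (1 / 4 ^ k)"
      by (elim disjE) (force intro: bexI[of _ p], force intro: bexI[of _ "branch \<alpha> p"],
          force intro: bexI[of _ "branch \<alpha> (2 * p)"])
    then show ?thesis
      by (simp add: dist_real_def abs_minus_commute)
  qed
  then have "cantor_factor \<alpha> \<subseteq> (\<Union>p\<in>G. cball p (2 / 4 ^ k))"
    by auto
  ultimately show ?thesis
    by blast
qed

section \<open>Size of the factor and dimension of its powers\<close>

lemma Icc_not_subset_cantor_factor:
  assumes "\<alpha> \<ge> 1" "x < y"
  shows "\<not> {x..y} \<subseteq> cantor_factor \<alpha>"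
proof -
  obtain F where F: "\<And>k. finite (F k)" "\<And>k. card (F k) \<le> 3 * 2 ^ k"
    "\<And>k. cantor_factor \<alpha> \<subseteq> (\<Union>p\<in>F k. cball p (2 / 4 ^ k))"
    using cantor_factor_finite_cover[OF assms(1)] by metis
  show ?thesis
  proof (rule Icc_not_subset_of_small_covers[OF F(1) F(3) _ _ assms(2)])
    show "(\<lambda>k. real (card (F k)) * (2 * (2 / 4 ^ k))) \<longlonglongrightarrow> 0"
    proof (rule tendsto_sandwich[OF _ _ tendsto_const])
      \<comment> \<open>Total length is the case of dimension \<open>n = 1\<close> and exponent
        \<open>s = 1 > 1/2\<close>.\<close>
      show "(\<lambda>k. real ((3 * 2 ^ k) ^ 1) * (4 / 4 ^ k) powr 1) \<longlonglongrightarrow> 0"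
        by (rule power_tendsto_0_dimension) auto
      have "real (card (F k)) \<le> real ((3 * 2 ^ k) ^ 1)" for k
        using F(2)[of k] by (simp only: of_nat_le_iff power_one_right)
      then show "\<forall>\<^sub>F k in sequentially. real (card (F k)) * (2 * (2 / 4 ^ k))
          \<le> real ((3 * 2 ^ k) ^ 1) * (4 / 4 ^ k) powr 1"
        by (intro always_eventually allI mult_mono) auto
    qed auto
  qed auto
qed

lemma hausdorff_dim_cantor_cube:
  assumes "\<alpha> \<ge> 1"
  shows "hausdorff_dim (vec_cube (cantor_factor \<alpha>) :: (real ^ 'n) set) = ennreal (real CARD('n) / 2)"
proof (rule hausdorff_dim_eqI)
  let ?n = "CARD('n)"
  fix s
  assume s: "s > real ?n / 2"
  obtain F where F: "\<And>k. finite (F k)" "\<And>k. card (F k) \<le> 3 * 2 ^ k"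
    "\<And>k. cantor_factor \<alpha> \<subseteq> (\<Union>p\<in>F k. cball p (2 / 4 ^ k))"
    using cantor_factor_finite_cover[OF assms] by metis
  note cover = vec_cube_finite_cover[where 'n = 'n, OF F(1) F(3)]
  show "hausdorff_measure s (vec_cube (cantor_factor \<alpha>) :: (real ^ 'n) set) = 0"
  proof (rule hausdorff_measure_eq_0I[OF cover(1) cover(3)])
    have "(\<lambda>k. real ?n * 2 * (1 / 4) ^ k) \<longlonglongrightarrow> 0"
      by (intro tendsto_mult_right_zero LIMSEQ_power_zero) simp
    then show "(\<lambda>k. real ?n * (2 / 4 ^ k)) \<longlonglongrightarrow> 0"
      by (simp add: power_one_over)
    show "(\<lambda>k. real (card (vec_cube (F k) :: (real ^ 'n) set)) * (2 * (real ?n * (2 / 4 ^ k))) powr s) \<longlonglongrightarrow> 0"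
    proof (rule tendsto_sandwich[OF _ _ tendsto_const])
      show "(\<lambda>k. real ((3 * 2 ^ k) ^ ?n) * (4 * real ?n / 4 ^ k) powr s) \<longlonglongrightarrow> 0"
        using s by (intro power_tendsto_0_dimension) auto
      have "card (vec_cube (F k) :: (real ^ 'n) set) \<le> (3 * 2 ^ k) ^ ?n" for k
        using cover(2)[of k] power_mono[OF F(2)[of k], of ?n] by linarith
      then have "real (card (vec_cube (F k) :: (real ^ 'n) set)) \<le> real ((3 * 2 ^ k) ^ ?n)" for k
        by (simp only: of_nat_le_iff)
      then show "\<forall>\<^sub>F k in sequentially. real (card (vec_cube (F k) :: (real ^ 'n) set))
            * (2 * (real ?n * (2 / 4 ^ k))) powr s
          \<le> real ((3 * 2 ^ k) ^ ?n) * (4 * real ?n / 4 ^ k) powr s"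
        by (intro always_eventually allI mult_mono) (auto simp: mult_ac)
    qed auto
    show "s > 0"
      using s by (rule le_less_trans[rotated]) simp
  qed auto
next
  fix s
  assume s: "0 \<le> s" "s < real CARD('n) / 2"
  \<comment> \<open>The change of base from 4 to 2; \<open>inv\<close> selects some digit sequence
    of the given number.\<close>
  define g where "g = (\<lambda>a. digit_sum 2 (inv (digit_sum 4) a))"
  have g: "(g (digit_sum 4 e) - digit_sum 2 e')\<^sup>2 \<le> 6 * \<bar>digit_sum 4 e - digit_sum 4 e'\<bar>" for e e'
    unfolding g_def using digit_sum_2_4_hoelder[of "inv (digit_sum 4) (digit_sum 4 e)" e']
    by (simp add: f_inv_into_f)
  \<comment> \<open>For \<open>e' = e\<close> the Hoelder bound is 0, so the selection made by
    \<open>inv\<close> does not matter.\<close>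
  have g_eq: "g (digit_sum 4 e) = digit_sum 2 e" for e
    using g[of e e] by simp
  define f :: "real ^ 'n \<Rightarrow> real ^ 'n" where "f x = (\<chi> i. g (x $ i))" for x
  show "hausdorff_measure s (vec_cube (cantor_factor \<alpha>) :: (real ^ 'n) set) \<noteq> 0"
  proof (rule hausdorff_measure_neq_0I[OF _ _ _ _ s])
    fix x y :: "real ^ 'n" and i
    assume "x \<in> vec_cube (range (digit_sum 4))" "y \<in> vec_cube (range (digit_sum 4))"
    then obtain e e' where e: "x $ i = digit_sum 4 e" "y $ i = digit_sum 4 e'"
      by (auto simp: vec_cube_def image_iff) metis
    have "(f x $ i - f y $ i)\<^sup>2 \<le> 6 * \<bar>x $ i - y $ i\<bar>"
      unfolding e f_def using g[of e e'] by (simp add: e g_eq)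
    also have "\<bar>x $ i - y $ i\<bar> \<le> dist x y"
      using component_le_norm_cart[of "x - y" i] by (simp add: dist_norm)
    finally show "(f x $ i - f y $ i)\<^sup>2 \<le> 6 * dist x y"
      by simp
  next
    show "cbox 0 1 \<subseteq> f ` vec_cube (range (digit_sum 4))"
    proof
      fix y :: "real ^ 'n"
      assume "y \<in> cbox 0 1"
      then have "\<exists>e. y $ i = digit_sum 2 e" for i
        using range_digit_sum_2 by (auto simp: mem_box_cart image_iff set_eq_iff)
      then obtain e where e: "\<And>i. y $ i = digit_sum 2 (e i)"
        by metis
      show "y \<in> f ` vec_cube (range (digit_sum 4))"
        by (rule image_eqI[of _ _ "\<chi> i. digit_sum 4 (e i)"])
           (auto simp: f_def vec_eq_iff e g_eq vec_cube_def)
    qed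
  qed (auto simp: vec_cube_def cantor_factor_def)
qed simp

text \<open>For \<open>w\<close> in the interval, \<open>w powr \<alpha> - 2\<close> lies in
  \<open>[0,1]\<close> and so has the form \<open>a + 2 * b\<close> with \<open>a\<close> and
  \<open>b\<close> in the digit set. Coordinates \<open>branch \<alpha> a\<close> and
  \<open>branch \<alpha> (2 * b)\<close> contribute \<open>1 + a\<close> and
  \<open>1 + 2 * b\<close> to the power sum, which is where the 2 comes from.\<close>

lemma pinned_distance_set_cantor_cube:
  assumes "\<alpha> > 0" and "CARD('n) \<ge> 2"
  shows "{2 powr (1 / \<alpha>)..3 powr (1 / \<alpha>)}
    \<subseteq> pinned_distance_set \<alpha> 0 (vec_cube (cantor_factor \<alpha>) :: (real ^ 'n) set)"
proof
  fix w
  assume w: "w \<in> {2 powr (1 / \<alpha>)..3 powr (1 / \<alpha>)}"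
  then have "w > 0"
    by (auto intro: less_le_trans[of 0 "2 powr (1 / \<alpha>)"])
  have "2 \<le> w powr \<alpha>" "w powr \<alpha> \<le> 3"
    using w assms powr_mono2[of \<alpha> "2 powr (1 / \<alpha>)" w] powr_mono2[of \<alpha> w "3 powr (1 / \<alpha>)"] \<open>w > 0\<close>
    by (auto simp: powr_powr)
  then have "w powr \<alpha> - 2 \<in> range (digit_sum 2)"
    by (simp add: range_digit_sum_2)
  then obtain e where e: "w powr \<alpha> - 2 = digit_sum 2 e"
    by blast
  define a where "a = digit_sum 4 (\<lambda>k. e (2 * k + 1))"
  define b where "b = digit_sum 4 (\<lambda>k. e (2 * k))"
  have ab: "w powr \<alpha> = 2 + a + 2 * b" "a \<in> range (digit_sum 4)" "b \<in> range (digit_sum 4)"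
    using digit_sum_2_split[of e] e by (simp_all add: a_def b_def)
  have nonneg: "a \<ge> 0" "b \<ge> 0"
    using ab(2,3) by (auto simp: digit_sum_nonneg)
  obtain i j :: 'n where ij: "i \<noteq> j"
    using assms(2) card_le_Suc0_iff_eq[of "UNIV :: 'n set"] by auto
  \<comment> \<open>All remaining coordinates are 0: this value belongs to the factor and adds
    nothing to the power sum.\<close>
  define x :: "real ^ 'n" where
    "x = (\<chi> k. if k = i then branch \<alpha> a else if k = j then branch \<alpha> (2 * b) else 0)"
  have "0 \<in> range (digit_sum 4)"
    using digit_sum_none[of 4] by (metis rangeI)
  then have "x \<in> vec_cube (cantor_factor \<alpha>)"
    using ab(2,3) by (auto simp: vec_cube_def x_def cantor_factor_def)
  moreover have "alpha_norm \<alpha> (x - 0) = w"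
  proof -
    have "(\<Sum>k\<in>UNIV. \<bar>x $ k\<bar> powr \<alpha>) = (\<Sum>k\<in>{i, j}. \<bar>x $ k\<bar> powr \<alpha>)"
      using assms(1) by (intro sum.mono_neutral_right) (auto simp: x_def)
    also have "\<dots> = branch \<alpha> a powr \<alpha> + branch \<alpha> (2 * b) powr \<alpha>"
      using ij by (simp add: x_def branch_nonneg)
    also have "\<dots> = w powr \<alpha>"
      using ab(1) assms(1) nonneg by (simp add: branch_powr)
    finally show ?thesis
      using \<open>w > 0\<close> assms(1) by (simp add: alpha_norm_def powr_powr)
  qed
  ultimately show "w \<in> pinned_distance_set \<alpha> 0 (vec_cube (cantor_factor \<alpha>) :: (real ^ 'n) set)"
    unfolding pinned_distance_set_def by blast
qed

theorem theorem8p2: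
  fixes \<alpha> :: real
  assumes "even CARD('n::finite)" and "CARD('n) \<ge> 2" and "\<alpha> > 1"
  shows "\<exists>K :: (real ^ 'n) set.
           cantor_set K \<and>
           hausdorff_dim K = ennreal (real CARD('n) / 2) \<and>
           (\<exists>t\<in>K. interior (pinned_distance_set \<alpha> t K) \<noteq> {})"
proof (intro exI conjI)
  let ?K = "vec_cube (cantor_factor \<alpha>) :: (real ^ 'n) set"
  have "0 \<in> range (digit_sum 4)"
    using digit_sum_none[of 4] by (metis rangeI)
  \<comment> \<open>The origin serves as the pin \<open>t\<close>.\<close>
  then have zero: "0 \<in> ?K"
    by (simp add: vec_cube_def cantor_factor_def)
  have compact: "compact ?K"
    by (intro compact_vec_cube compact_cantor_factor)
  moreover have "totally_disconnected ?K"
    using assms(3) by (intro totally_disconnected_vec_cube Icc_not_subset_cantor_factor) auto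
  moreover have "perfect ?K"
    unfolding perfect_def using assms(3) compact
    by (auto intro!: compact_imp_closed islimpt_vec_cube islimpt_cantor_factor)
  ultimately show "cantor_set ?K"
    using zero by (auto simp: cantor_set_def)
  show "hausdorff_dim ?K = ennreal (real CARD('n) / 2)"
    using assms(3) by (intro hausdorff_dim_cantor_cube) simp
  have "interior {2 powr (1 / \<alpha>)..3 powr (1 / \<alpha>)} \<subseteq> interior (pinned_distance_set \<alpha> 0 ?K)"
    using assms by (intro interior_mono pinned_distance_set_cantor_cube) auto
  moreover have "(2 :: real) powr (1 / \<alpha>) < 3 powr (1 / \<alpha>)"
    using assms(3) by (intro powr_less_mono2) auto
  ultimately have "interior (pinned_distance_set \<alpha> 0 ?K) \<noteq> {}"
    by (auto simp: interior_atLeastAtMost_real greaterThanLessThan_empty_iff)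
  with zero show "\<exists>t\<in>?K. interior (pinned_distance_set \<alpha> t ?K) \<noteq> {}"
    by blast
qed

end
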